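(* Let $D\subset\mathbb C$ be a bounded convex domain and $p\in D$. There exists a harmonic map $f:\mathbb D\to D$ such that $f(0)=p$, $df_0$ is conformal, and $\|df_0\|=M_D(p)$. Furthermore, \[ M_D(p)\le \frac{\operatorname{Per}(D)}{2\pi}. \]
   Context: $\mathbb D=\{z\in\mathbb C:|z|<1\}$. For a domain $D\subset\mathbb C$ and $p\in D$, $M_D(p)$ denotes the supremum of the operator norms $\|df_0\|$ over all harmonic maps $f:\mathbb D\to D$ with $f(0)=p$ whose differential $df_0:\mathbb R^2\to\mathbb R^2$ at $0$ is conformal (i.e. a nonnegative multiple of an orthogonal linear map, orientation preserving or reversing). $\operatorname{Per}(D)$ denotes the perimeter of $D$. *)

theory Defs
  imports "HOL-Analysis.Analysis"
begin

definition harmonic_on :: "complex set \<Rightarrow> (complex \<Rightarrow> complex) \<Rightarrow> bool" where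
  "harmonic_on S f \<longleftrightarrow>
     (\<exists>fx fy fxx fxy fyx fyy.
        (\<forall>z\<in>S. (f has_derivative (\<lambda>h. Re h *\<^sub>R fx z + Im h *\<^sub>R fy z)) (at z)) \<and>
        (\<forall>z\<in>S. (fx has_derivative (\<lambda>h. Re h *\<^sub>R fxx z + Im h *\<^sub>R fxy z)) (at z)) \<and>
        (\<forall>z\<in>S. (fy has_derivative (\<lambda>h. Re h *\<^sub>R fyx z + Im h *\<^sub>R fyy z)) (at z)) \<and>
        continuous_on S fxx \<and> continuous_on S fxy \<and>
        continuous_on S fyx \<and> continuous_on S fyy \<and>
        (\<forall>z\<in>S. fxx z + fyy z = 0))"

text \<open>A real-linear map of R^2 = C is conformal iff it is a nonnegative multiple of an orthogonal
  map, i.e. of the form h |-> c*h (orientation preserving) or h |-> c * cnj h (reversing).\<close>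
definition conformal_linear :: "(complex \<Rightarrow> complex) \<Rightarrow> bool" where
  "conformal_linear L \<longleftrightarrow> (\<exists>c. (\<forall>h. L h = c * h) \<or> (\<forall>h. L h = c * cnj h))"

definition admissible :: "complex set \<Rightarrow> complex \<Rightarrow> (complex \<Rightarrow> complex) \<Rightarrow> bool" where
  "admissible D p f \<longleftrightarrow> harmonic_on (ball 0 1) f \<and> f ` ball 0 1 \<subseteq> D \<and> f 0 = p \<and>
     conformal_linear (frechet_derivative f (at 0))"

definition M :: "complex set \<Rightarrow> complex \<Rightarrow> real" where
  "M D p = Sup {onorm (frechet_derivative f (at 0)) | f. admissible D p f}"

definition curve_length :: "(real \<Rightarrow> complex) \<Rightarrow> real" where
  "curve_length g = Sup {(\<Sum>i<n. norm (g (t (Suc i)) - g (t i))) | n t.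
      t 0 = 0 \<and> t n = 1 \<and> (\<forall>i<n. t i \<le> t (Suc i))}"

definition perimeter :: "complex set \<Rightarrow> real" where
  "perimeter D = (SOME L. \<exists>g. simple_path g \<and> pathstart g = pathfinish g \<and>
      path_image g = frontier D \<and> curve_length g = L)"

end

theory Submission
  imports Defs "HOL-Complex_Analysis.Complex_Analysis"
begin

text \<open>
  Write a harmonic map as \<open>f = h + cnj g\<close> with \<open>h\<close>, \<open>g\<close> holomorphic. If \<open>f\<close> maps the disc into \<open>D\<close>,
  then \<open>h'(0)\<close> is the first Fourier coefficient of \<open>f\<close> on circles, so \<open>2 r |h'(0)|\<close> is an average over
  unit vectors \<open>e\<close> of \<open>(f(z) - f(-z)) \<bullet> e\<close> with \<open>|z| = r\<close>, which is at most the average width of \<open>D\<close>.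
  The width in direction \<open>e\<close> is, up to \<open>\<epsilon>\<close>, at most half the total variation of \<open>v \<bullet> e\<close> along a fine
  polygon inscribed in the boundary, and since \<open>|v \<bullet> e|\<close> averages to \<open>2 |v| / \<pi>\<close> this gives Cauchy's formula
  in the form \<open>|h'(0)| \<le> Per(D) / 2\<pi>\<close>. Rescaling discs, the same estimate bounds \<open>h'\<close> and \<open>g'\<close> locally
  uniformly, so Montel's theorem yields an extremal map into the closure of \<open>D\<close>; by the maximum
  principle applied to supporting half-planes it does not touch the boundary.
\<close>

section \<open>Harmonic maps and holomorphic functions\<close>

text \<open>Apply the mean value inequality on \<open>{0..s}\<close> to t |-> f(z + ta + sb) - f(z +
  ta) - ts A b. Its derivative compares the derivative in direction \<open>a\<close> at two points
  near z, and the first-order expansion of \<open>f' w a\<close> at z controls both.\<close>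

lemma second_difference_bound:
  fixes f :: "'a::real_normed_vector \<Rightarrow> 'b::real_normed_vector"
  assumes S: "open S" "z \<in> S" and f': "\<And>w. w \<in> S \<Longrightarrow> (f has_derivative f' w) (at w)"
    and A: "((\<lambda>w. f' w a) has_derivative A) (at z)" and e: "e > 0"
  shows "\<exists>d>0. \<forall>s. 0 < s \<and> s < d \<longrightarrow>
    norm (f (z + s *\<^sub>R a + s *\<^sub>R b) - f (z + s *\<^sub>R a) - f (z + s *\<^sub>R b) + f z - s\<^sup>2 *\<^sub>R A b) \<le> e * s\<^sup>2"
proof -
  interpret A: bounded_linear A using A by (rule has_derivative_bounded_linear)
  \<comment> \<open>Every displacement \<open>t *\<^sub>R a + u *\<^sub>R b\<close> with t, u in
    [0, s] has norm at most \<open>s * N\<close>. Two remainders of size \<open>e' * (s * N)\<close>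
    then add up to \<open>e * s\<close>.\<close>
  define N where "N = norm a + norm b + 1"
  have N: "N > 0" unfolding N_def by (smt (verit) norm_ge_zero)
  define e' where "e' = e / (2 * N)"
  have e': "e' > 0" using e N by (simp add: e'_def)
  obtain d1 where d1: "d1 > 0" "\<And>y. norm (y - z) < d1 \<Longrightarrow> 
      norm (f' y a - f' z a - A (y - z)) \<le> e' * norm (y - z)"
    using A e' unfolding has_derivative_at_alt by blast
  obtain d2 where d2: "d2 > 0" "ball z d2 \<subseteq> S" using S open_contains_ball by blast
  define d where "d = min d1 d2 / N"
  have d: "d > 0" using d1 d2 N by (simp add: d_def)
  show ?thesis
  proof (intro exI[of _ d] conjI allI impI d)
    fix s assume s: "0 < s \<and> s < d"
    have sN: "s * N < d1" "s * N < d2" using s N by (auto simp: d_def field_simps)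
    define \<psi> where "\<psi> t = f (z + t *\<^sub>R a + s *\<^sub>R b) - f (z + t *\<^sub>R a) - t *\<^sub>R s *\<^sub>R A b" for t
    have small: "norm (t *\<^sub>R a + u *\<^sub>R b) \<le> s * N" if "0 \<le> t" "t \<le> s" "0 \<le> u" "u \<le> s" for t u
    proof -
      have "norm (t *\<^sub>R a + u *\<^sub>R b) \<le> t * norm a + u * norm b"
        using norm_triangle_ineq[of "t *\<^sub>R a" "u *\<^sub>R b"] that by simp
      also have "\<dots> \<le> s * norm a + s * norm b"
        using that by (intro add_mono mult_right_mono) auto
      also have "\<dots> \<le> s * N" using s by (simp add: N_def algebra_simps)
      finally show ?thesis .
    qed
    have inS: "z + t *\<^sub>R a + u *\<^sub>R b \<in> S" if "0 \<le> t" "t \<le> s" "0 \<le> u" "u \<le> s" for t u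
    proof -
      have "dist z (z + t *\<^sub>R a + u *\<^sub>R b) = norm (t *\<^sub>R a + u *\<^sub>R b)"
        by (simp add: dist_norm norm_minus_commute add.commute)
      then show ?thesis using small[OF that] sN d2(2) by (auto simp: subset_iff)
    qed
    have bnd: "norm (f' (z + t *\<^sub>R a + u *\<^sub>R b) a - f' z a - A (t *\<^sub>R a + u *\<^sub>R b)) \<le> e' * (s * N)"
      if "0 \<le> t" "t \<le> s" "0 \<le> u" "u \<le> s" for t u
    proof -
      have "norm (f' (z + t *\<^sub>R a + u *\<^sub>R b) a - f' z a - A (t *\<^sub>R a + u *\<^sub>R b)) \<le> e' * norm (t *\<^sub>R a + u *\<^sub>R b)"
        using d1(2)[of "z + t *\<^sub>R a + u *\<^sub>R b"] small[OF that] sN by (simp add: add.assoc)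
      also have "\<dots> \<le> e' * (s * N)" using small[OF that] e' by simp
      finally show ?thesis .
    qed
    have "norm (\<psi> s - \<psi> 0) \<le> (e * s) * norm (s - 0)"
    proof (rule differentiable_bound[where S="{0..s}" and f=\<psi> and 
          f'="\<lambda>t h. h *\<^sub>R (f' (z + t *\<^sub>R a + s *\<^sub>R b) a - f' (z + t *\<^sub>R a) a - s *\<^sub>R A b)"])
      fix t assume t: "t \<in> {0..s}"
      interpret L1: bounded_linear "f' (z + t *\<^sub>R a + s *\<^sub>R b)"
        using f'[OF inS[of t s]] t s by (auto intro: has_derivative_bounded_linear)
      interpret L2: bounded_linear "f' (z + t *\<^sub>R a)"
        using f'[OF inS[of t 0]] t s by (auto intro: has_derivative_bounded_linear)
      have 1: "((\<lambda>t. f (z + t *\<^sub>R a + s *\<^sub>R b)) has_derivative (\<lambda>h. f' (z + t *\<^sub>R a + s *\<^sub>R b) (h *\<^sub>R a))) (at t within {0..s})"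
        by (rule has_derivative_compose[of "\<lambda>t. z + t *\<^sub>R a + s *\<^sub>R b"])
          (use f'[OF inS[of t s]] t s in \<open>auto intro!: derivative_eq_intros\<close>)
      have 2: "((\<lambda>t. f (z + t *\<^sub>R a)) has_derivative (\<lambda>h. f' (z + t *\<^sub>R a) (h *\<^sub>R a))) (at t within {0..s})"
        by (rule has_derivative_compose[of "\<lambda>t. z + t *\<^sub>R a"])
          (use f'[OF inS[of t 0]] t s in \<open>auto intro!: derivative_eq_intros\<close>)
      show "(\<psi> has_derivative (\<lambda>h. h *\<^sub>R (f' (z + t *\<^sub>R a + s *\<^sub>R b) a - f' (z + t *\<^sub>R a) a - s *\<^sub>R A b))) (at t within {0..s})"
        unfolding \<psi>_def
        by (rule derivative_eq_intros 1 2 refl)+ (simp add: L1.scaleR L2.scaleR scaleR_diff_right)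
      have "norm (f' (z + t *\<^sub>R a + s *\<^sub>R b) a - f' (z + t *\<^sub>R a) a - s *\<^sub>R A b) \<le> e' * (s * N) + e' * (s * N)"
      proof -
        let ?P = "\<lambda>u. f' (z + t *\<^sub>R a + u *\<^sub>R b) a - f' z a - A (t *\<^sub>R a + u *\<^sub>R b)"
        have "f' (z + t *\<^sub>R a + s *\<^sub>R b) a - f' (z + t *\<^sub>R a) a - s *\<^sub>R A b = ?P s - ?P 0"
          by (simp add: A.add A.scaleR)
        moreover have "norm (?P s - ?P 0) \<le> e' * (s * N) + e' * (s * N)"
          by (rule order_trans[OF norm_triangle_ineq4], rule add_mono; rule bnd) (use t s in auto)
        ultimately show ?thesis by metis
      qed
      also have "\<dots> = e * s" using N by (simp add: e'_def field_simps)
      finally show "onorm (\<lambda>h. h *\<^sub>R (f' (z + t *\<^sub>R a + s *\<^sub>R b) a - f' (z + t *\<^sub>R a) a - s *\<^sub>R A b)) \<le> e * s"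
        by (intro onorm_le) (simp add: mult.commute mult_left_mono)
    qed (use s in auto)
    then show "norm (f (z + s *\<^sub>R a + s *\<^sub>R b) - f (z + s *\<^sub>R a) - f (z + s *\<^sub>R b) + f z - s\<^sup>2 *\<^sub>R A b) \<le> e * s\<^sup>2"
      using s by (simp add: \<psi>_def power2_eq_square algebra_simps)
  qed
qed

text \<open>The second difference of f is symmetric in \<open>a\<close> and \<open>b\<close>, so
  \<open>A b\<close> and \<open>B a\<close> both approximate its quotient by s^2. This makes the
  mixed partials of a harmonic map agree.\<close>

lemma second_derivative_symmetric:
  fixes f :: "'a::real_normed_vector \<Rightarrow> 'b::real_normed_vector"
  assumes S: "open S" "z \<in> S" and f': "\<And>w. w \<in> S \<Longrightarrow> (f has_derivative f' w) (at w)"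
    and A: "((\<lambda>w. f' w a) has_derivative A) (at z)"
    and B: "((\<lambda>w. f' w b) has_derivative B) (at z)"
  shows "A b = B a"
proof (rule ccontr)
  assume "A b \<noteq> B a"
  define e where "e = norm (A b - B a) / 4"
  have e: "e > 0" using \<open>A b \<noteq> B a\<close> by (simp add: e_def)
  let ?X = "\<lambda>s. f (z + s *\<^sub>R a + s *\<^sub>R b) - f (z + s *\<^sub>R a) - f (z + s *\<^sub>R b) + f z"
  obtain d1 where d1: "d1 > 0" "\<And>s. 0 < s \<Longrightarrow> s < d1 \<Longrightarrow> norm (?X s - s\<^sup>2 *\<^sub>R A b) \<le> e * s\<^sup>2"
    using second_difference_bound[OF S f' A e, of b] by blast
  obtain d2 where d2: "d2 > 0" "\<And>s. 0 < s \<Longrightarrow> s < d2 \<Longrightarrow> 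
      norm (f (z + s *\<^sub>R b + s *\<^sub>R a) - f (z + s *\<^sub>R b) - f (z + s *\<^sub>R a) + f z - s\<^sup>2 *\<^sub>R B a) \<le> e * s\<^sup>2"
    using second_difference_bound[OF S f' B e, of a] by blast
  define s where "s = min d1 d2 / 2"
  have s: "0 < s" "s < d1" "s < d2" using d1 d2 by (auto simp: s_def)
  have "norm (?X s - s\<^sup>2 *\<^sub>R B a) \<le> e * s\<^sup>2"
    using d2(2)[of s] s by (simp add: algebra_simps)
  moreover have "norm (?X s - s\<^sup>2 *\<^sub>R A b) \<le> e * s\<^sup>2" using d1(2) s by blast
  moreover have "s\<^sup>2 *\<^sub>R (A b - B a) = (?X s - s\<^sup>2 *\<^sub>R B a) - (?X s - s\<^sup>2 *\<^sub>R A b)"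
    by (simp add: algebra_simps)
  ultimately have "norm (s\<^sup>2 *\<^sub>R (A b - B a)) \<le> e * s\<^sup>2 + e * s\<^sup>2"
    by (metis (no_types, lifting) add_mono norm_triangle_le_diff)
  then have "s\<^sup>2 * (4 * e) \<le> s\<^sup>2 * (2 * e)" by (simp add: e_def)
  then show False using s e by (simp add: mult_le_cancel_left)
qed

text \<open>Here \<open>P\<close> is the Wirtinger derivative of f in z, and \<open>Q\<close> is the
  conjugate of the one in the conjugate variable. Equal mixed partials and the vanishing Laplacian
  give the Cauchy-Riemann equations for both. With primitives \<open>h\<close> and \<open>g\<close>
  on the convex set, f - h - cnj g has zero derivative, and the resulting constant is absorbed into
  \<open>h\<close>.\<close>

lemma harmonic_on_imp_holomorphic_decomposition:
  assumes S: "open S" "convex S" and f: "harmonic_on S f"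
  obtains h g where "h holomorphic_on S" "g holomorphic_on S" "\<And>z. z \<in> S \<Longrightarrow> f z = h z + cnj (g z)"
proof -
  obtain fx fy fxx fxy fyx fyy where
    f1: "\<And>z. z \<in> S \<Longrightarrow> (f has_derivative (\<lambda>h. Re h *\<^sub>R fx z + Im h *\<^sub>R fy z)) (at z)" and
    fx: "\<And>z. z \<in> S \<Longrightarrow> (fx has_derivative (\<lambda>h. Re h *\<^sub>R fxx z + Im h *\<^sub>R fxy z)) (at z)" and
    fy: "\<And>z. z \<in> S \<Longrightarrow> (fy has_derivative (\<lambda>h. Re h *\<^sub>R fyx z + Im h *\<^sub>R fyy z)) (at z)" and
    lap: "\<And>z. z \<in> S \<Longrightarrow> fxx z + fyy z = 0"
    using f unfolding harmonic_on_def by blast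
  have sym: "fxy z = fyx z" if "z \<in> S" for z
    using second_derivative_symmetric[OF S(1) that f1, of 1 _ \<i>] fx[OF that] fy[OF that] by fastforce
  have lap': "fyy z = - fxx z" if "z \<in> S" for z using lap[OF that] by (simp add: eq_neg_iff_add_eq_0 add.commute)
  define P where "P z = (fx z - \<i> * fy z) / 2" for z
  define Q where "Q z = cnj ((fx z + \<i> * fy z) / 2)" for z
  have "(P has_field_derivative (fxx z - \<i> * fyx z) / 2) (at z)" if "z \<in> S" for z
    unfolding has_field_derivative_def P_def
    by (rule derivative_eq_intros fx fy that refl | simp)+
      (auto simp: fun_eq_iff sym[OF that] lap'[OF that] complex_eq_iff algebra_simps add_divide_distrib diff_divide_distrib)
  then have P: "P holomorphic_on S" using S(1) by (auto simp: holomorphic_on_open)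
  have "(Q has_field_derivative cnj ((fxx z + \<i> * fyx z) / 2)) (at z)" if "z \<in> S" for z
    unfolding has_field_derivative_def Q_def
    by (rule derivative_eq_intros fx fy that refl | simp)+
      (auto simp: fun_eq_iff sym[OF that] lap'[OF that] complex_eq_iff algebra_simps add_divide_distrib diff_divide_distrib)
  then have Q: "Q holomorphic_on S" using S(1) by (auto simp: holomorphic_on_open)
  obtain h where h: "\<And>z. z \<in> S \<Longrightarrow> (h has_field_derivative P z) (at z)"
    using holomorphic_convex_primitive'[OF S(2,1) P] S(1) by (metis at_within_open)
  obtain g where g: "\<And>z. z \<in> S \<Longrightarrow> (g has_field_derivative Q z) (at z)"
    using holomorphic_convex_primitive'[OF S(2,1) Q] S(1) by (metis at_within_open)
  have "((\<lambda>z. f z - h z - cnj (g z)) has_derivative (\<lambda>_. 0)) (at z within S)" if "z \<in> S" for z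
  proof -
    have "((\<lambda>z. f z - h z - cnj (g z)) has_derivative (\<lambda>_. 0)) (at z)"
      by (rule derivative_eq_intros f1 that h[OF that, unfolded has_field_derivative_def]
          g[OF that, unfolded has_field_derivative_def] refl | simp)+
        (auto simp: fun_eq_iff P_def Q_def complex_eq_iff field_simps)
    then show ?thesis by (rule has_derivative_at_withinI)
  qed
  from has_derivative_zero_constant[OF S(2) this]
  obtain c where c: "\<And>z. z \<in> S \<Longrightarrow> f z - h z - cnj (g z) = c" by blast
  show ?thesis
  proof (rule that[of "\<lambda>z. h z + c" g])
    show "g holomorphic_on S" using g S(1) by (auto simp: holomorphic_on_open)
    have "h holomorphic_on S" using h S(1) by (auto simp: holomorphic_on_open)
    then show "(\<lambda>z. h z + c) holomorphic_on S" by (intro holomorphic_intros)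
    show "f z = (h z + c) + cnj (g z)" if "z \<in> S" for z
      using c[OF that] by (auto simp: algebra_simps)
  qed
qed

lemma has_derivative_holomorphic_plus_cnj:
  assumes "open S" "h holomorphic_on S" "g holomorphic_on S" "z \<in> S"
  shows "((\<lambda>z. h z + cnj (g z)) has_derivative (\<lambda>k. deriv h z * k + cnj (deriv g z * k))) (at z)"
  by (rule derivative_eq_intros
      holomorphic_derivI[OF assms(2,1,4), unfolded has_field_derivative_def]
      holomorphic_derivI[OF assms(3,1,4), unfolded has_field_derivative_def] refl)+

lemma harmonic_on_holomorphic_plus_cnj:
  assumes S: "open S" and h: "h holomorphic_on S" and g: "g holomorphic_on S"
  shows "harmonic_on S (\<lambda>z. h z + cnj (g z))"
proof -
  note h1 = holomorphic_deriv[OF h S] and g1 = holomorphic_deriv[OF g S]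
  note h2 = holomorphic_deriv[OF h1 S] and g2 = holomorphic_deriv[OF g1 S]
  note c = holomorphic_on_imp_continuous_on
  let ?h' = "deriv h" and ?g' = "deriv g"
  let ?h = "deriv ?h'" and ?g = "deriv ?g'"
  have ih: "(\<lambda>z. \<i> * ?h' z) holomorphic_on S" and ig: "(\<lambda>z. \<i> * ?g' z) holomorphic_on S"
    by (intro holomorphic_intros h1 g1)+
  have d: "deriv (\<lambda>z. \<i> * ?h' z) z = \<i> * ?h z" "deriv (\<lambda>z. \<i> * ?g' z) z = \<i> * ?g z" if "z \<in> S" for z
    using holomorphic_on_imp_differentiable_at[OF h1 S that] holomorphic_on_imp_differentiable_at[OF g1 S that]
    by simp_all
  show ?thesis
    unfolding harmonic_on_def
  \<comment> \<open>For a holomorphic function the partial in x is the complex derivative and the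
    partial in y is \<i> times it. Applying this to \<open>h\<close> and \<open>g\<close> once and
    twice gives all six witnesses.\<close>
  proof (rule exI[of _ "\<lambda>z. ?h' z + cnj (?g' z)"], rule exI[of _ "\<lambda>z. \<i> * ?h' z + cnj (\<i> * ?g' z)"],
      rule exI[of _ "\<lambda>z. ?h z + cnj (?g z)"], rule exI[of _ "\<lambda>z. \<i> * ?h z + cnj (\<i> * ?g z)"],
      rule exI[of _ "\<lambda>z. \<i> * ?h z + cnj (\<i> * ?g z)"], rule exI[of _ "\<lambda>z. - ?h z - cnj (?g z)"],
      intro conjI ballI)
    fix z assume z: "z \<in> S"
    show "((\<lambda>z. h z + cnj (g z)) has_derivative (\<lambda>k. Re k *\<^sub>R (?h' z + cnj (?g' z)) + Im k *\<^sub>R (\<i> * ?h' z + cnj (\<i> * ?g' z)))) (at z)"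
      by (rule has_derivative_eq_rhs[OF has_derivative_holomorphic_plus_cnj[OF S h g z]])
        (auto simp: fun_eq_iff complex_eq_iff algebra_simps)
    show "((\<lambda>z. ?h' z + cnj (?g' z)) has_derivative (\<lambda>k. Re k *\<^sub>R (?h z + cnj (?g z)) + Im k *\<^sub>R (\<i> * ?h z + cnj (\<i> * ?g z)))) (at z)"
      by (rule has_derivative_eq_rhs[OF has_derivative_holomorphic_plus_cnj[OF S h1 g1 z]])
        (auto simp: fun_eq_iff complex_eq_iff algebra_simps)
    show "((\<lambda>z. \<i> * ?h' z + cnj (\<i> * ?g' z)) has_derivative (\<lambda>k. Re k *\<^sub>R (\<i> * ?h z + cnj (\<i> * ?g z)) + Im k *\<^sub>R (- ?h z - cnj (?g z)))) (at z)"
      by (rule has_derivative_eq_rhs[OF has_derivative_holomorphic_plus_cnj[OF S ih ig z]])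
        (auto simp: d[OF z] fun_eq_iff complex_eq_iff algebra_simps)
  qed (auto intro!: continuous_intros c[OF h2] c[OF g2])
qed

section \<open>Polygons inscribed in a convex curve\<close>

text \<open>A shift by a multiple of pi brings the phase into [-pi/2, pi/2) and preserves the
  absolute value. The cosine then changes sign on [0, 1] only at \<open>t1\<close> and
  \<open>t2\<close>, where its argument is pi/2 and 3 pi/2.\<close>

lemma abs_cos_has_integral_period:
  "((\<lambda>t. \<bar>cos (2 * pi * t + \<beta>)\<bar>) has_integral 2 / pi) {0..1}"
proof -
  define k where "k = \<lfloor>\<beta> / pi + 1/2\<rfloor>"
  define b where "b = \<beta> - of_int k * pi"
  have "of_int k \<le> \<beta> / pi + 1/2" "\<beta> / pi + 1/2 < of_int k + 1" unfolding k_def by linarith+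
  then have b: "-pi/2 \<le> b" "b < pi/2" unfolding b_def by (auto simp: field_simps)
  have eq: "\<bar>cos (2 * pi * t + \<beta>)\<bar> = \<bar>cos (2 * pi * t + b)\<bar>" for t
  proof -
    have "2 * pi * t + \<beta> = (2 * pi * t + b) + of_int k * pi" by (simp add: b_def)
    then have "cos (2 * pi * t + \<beta>) = cos (2 * pi * t + b) * cos (of_int k * pi)"
      by (simp only: cos_add) (simp add: sin_times_pi_eq_0)
    moreover have "\<bar>cos (of_int k * pi)\<bar> = 1"
      using sin_zero_abs_cos_one[of "of_int k * pi"] by (simp add: sin_times_pi_eq_0)
    ultimately show ?thesis by (simp add: abs_mult)
  qed
  define t1 where "t1 = (pi/2 - b) / (2 * pi)"
  define t2 where "t2 = (3 * pi/2 - b) / (2 * pi)"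
  have t: "0 \<le> t1" "t1 \<le> t2" "t2 \<le> 1" using b by (auto simp: t1_def t2_def field_simps)
  have e1: "2 * pi * t1 + b = pi/2" and e2: "2 * pi * t2 + b = pi/2 + pi"
    by (auto simp: t1_def t2_def field_simps)
  let ?F = "\<lambda>t. sin (2 * pi * t + b) / (2 * pi)"
  have ftc: "((\<lambda>t. cos (2 * pi * t + b)) has_integral (?F d - ?F c)) {c..d}" if "c \<le> d" for c d
    by (rule fundamental_theorem_of_calculus[OF that])
      (auto intro!: derivative_eq_intros simp: has_real_derivative_iff_has_vector_derivative[symmetric] field_simps)
  have i1: "((\<lambda>t. \<bar>cos (2 * pi * t + b)\<bar>) has_integral (?F t1 - ?F 0)) {0..t1}"
  proof (rule has_integral_eq[OF _ ftc[OF t(1)]])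
    fix x assume x: "x \<in> {0..t1}"
    then have "2 * pi * x \<le> 2 * pi * t1" "0 \<le> 2 * pi * x" by auto
    then show "cos (2 * pi * x + b) = \<bar>cos (2 * pi * x + b)\<bar>"
      using b e1 cos_ge_zero[of "2 * pi * x + b"] by linarith
  qed
  have i2: "((\<lambda>t. \<bar>cos (2 * pi * t + b)\<bar>) has_integral - (?F t2 - ?F t1)) {t1..t2}"
  proof (rule has_integral_eq[OF _ has_integral_neg[OF ftc[OF t(2)]]])
    fix x assume x: "x \<in> {t1..t2}"
    then have "2 * pi * t1 \<le> 2 * pi * x" "2 * pi * x \<le> 2 * pi * t2" by auto
    then have "cos (2 * pi * x + b - pi) \<ge> 0"
      using b e1 e2 by (intro cos_ge_zero) linarith+
    then show "- cos (2 * pi * x + b) = \<bar>cos (2 * pi * x + b)\<bar>" by simp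
  qed
  have i3: "((\<lambda>t. \<bar>cos (2 * pi * t + b)\<bar>) has_integral (?F 1 - ?F t2)) {t2..1}"
  proof (rule has_integral_eq[OF _ ftc[OF t(3)]])
    fix x assume x: "x \<in> {t2..1}"
    then have "2 * pi * t2 \<le> 2 * pi * x" "2 * pi * x \<le> 2 * pi" by auto
    then have "cos (2 * pi * x + b - 2 * pi) \<ge> 0"
      using b e2 by (intro cos_ge_zero) linarith+
    then show "cos (2 * pi * x + b) = \<bar>cos (2 * pi * x + b)\<bar>" by (simp add: cos_diff)
  qed
  have "((\<lambda>t. \<bar>cos (2 * pi * t + b)\<bar>) has_integral ((?F t1 - ?F 0) + - (?F t2 - ?F t1) + (?F 1 - ?F t2))) {0..1}"
    using has_integral_combine[OF _ _ has_integral_combine[OF _ _ i1 i2] i3] t by simp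
  moreover have "?F t1 = 1 / (2 * pi)" "?F t2 = - 1 / (2 * pi)"
    unfolding e1 e2 by (simp_all only: sin_periodic_pi sin_pi_half)
  moreover have "?F 1 = ?F 0" by (simp add: sin_add)
  ultimately show ?thesis unfolding eq by (simp add: field_simps)
qed

text \<open>In polar form the inner product is \<open>norm v\<close> times a cosine with shifted
  phase. This is the averaging step of Cauchy's formula: projected lengths over all directions
  recover the length.\<close>

lemma abs_inner_circle_has_integral:
  fixes v w :: complex
  assumes "norm w = 1"
  shows "((\<lambda>t. \<bar>v \<bullet> (w * exp (2 * of_real pi * \<i> * of_real t))\<bar>) has_integral 2 / pi * norm v) {0..1}"
proof -
  obtain a where v: "v = rcis (norm v) a" by (metis rcis_cmod_Arg)
  obtain c where w: "w = cis c" using assms by (metis cis_Arg_unique rcis_cmod_Arg rcis_def mult_1 of_real_1)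
  have *: "norm v * \<bar>cos (2 * pi * t + (c - a))\<bar> = \<bar>v \<bullet> (w * exp (2 * of_real pi * \<i> * of_real t))\<bar>" for t
  proof -
    have "w * exp (2 * of_real pi * \<i> * of_real t) = cis (c + 2 * pi * t)"
      unfolding w cis_mult[symmetric] by (simp add: cis_conv_exp mult_ac)
    then have "v \<bullet> (w * exp (2 * of_real pi * \<i> * of_real t)) = norm v * cos (c + 2 * pi * t - a)"
      by (subst v) (simp add: inner_complex_def rcis_def cos_diff algebra_simps)
    then show ?thesis by (simp add: abs_mult algebra_simps)
  qed
  show ?thesis
    using has_integral_mult_right[OF abs_cos_has_integral_period[of "c - a"], of "norm v"]
    unfolding * by (simp add: mult.commute)
qed

text \<open>The closed polygon goes from \<open>v j\<close> to \<open>v k\<close> and returns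
  through \<open>v n = v 0\<close>, so it covers the distance between the two values twice.\<close>

lemma closed_polygon_variation_ge:
  fixes v :: "nat \<Rightarrow> real"
  assumes "v n = v 0" "j \<le> n" "k \<le> n"
  shows "2 * \<bar>v j - v k\<bar> \<le> (\<Sum>i<n. \<bar>v (Suc i) - v i\<bar>)"
  using assms(2,3)
proof (induction j k rule: linorder_wlog)
  case (le j k)
  have seg: "\<bar>v b - v a\<bar> \<le> (\<Sum>i=a..<b. \<bar>v (Suc i) - v i\<bar>)" if "a \<le> b" for a b
    using sum_abs[of "\<lambda>i. v (Suc i) - v i" "{a..<b}"] sum_Suc_diff'[OF that, of v] by simp
  have "(\<Sum>i<n. \<bar>v (Suc i) - v i\<bar>) = (\<Sum>i=0..<j. \<bar>v (Suc i) - v i\<bar>) + (\<Sum>i=j..<k. \<bar>v (Suc i) - v i\<bar>) + (\<Sum>i=k..<n. \<bar>v (Suc i) - v i\<bar>)"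
    using le by (simp add: sum.atLeastLessThan_concat lessThan_atLeast0)
  moreover have tri: "2 * \<bar>x - y\<bar> \<le> p + q + r" if "\<bar>x - z\<bar> \<le> p" "\<bar>y - x\<bar> \<le> q" "\<bar>z - y\<bar> \<le> r" for x y z p q r :: real
    using that by (cases "x \<le> y") (simp_all add: abs_le_iff)
  ultimately show ?case using tri[OF seg[OF le0[of j]] seg[OF le(1)] seg[OF le(3), unfolded assms(1)]] by simp
next
  case (sym j k)
  then show ?case by (simp add: abs_minus_commute)
qed

text \<open>From a point of D, moving in direction \<open>u\<close> raises the inner product with
  \<open>u\<close> until the frontier is met. By uniform continuity some vertex of a fine polygon
  lies within \<open>e / 2\<close> of that exit point. The fineness \<open>n\<close> serves all
  directions \<open>u\<close> at once, so the bound can later be integrated over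
  \<open>u\<close>.\<close>

lemma frontier_loop_polygon_width:
  fixes D :: "complex set"
  assumes D: "open D" "bounded D"
    and g: "path g" "pathstart g = pathfinish g" "path_image g = frontier D" and e: "e > 0"
  obtains n where "n > 0" "\<And>u x y :: complex. \<lbrakk>norm u = 1; x \<in> D; y \<in> D\<rbrakk> \<Longrightarrow>
    (x - y) \<bullet> u \<le> (\<Sum>i<n. \<bar>(g (real (Suc i) / real n) - g (real i / real n)) \<bullet> u\<bar>) / 2 + e"
proof -
  have "uniformly_continuous_on {0..1} g"
    using g(1) by (auto simp: path_def intro: compact_uniformly_continuous)
  then obtain d where d: "d > 0" "\<And>s t. \<lbrakk>s \<in> {0..1}; t \<in> {0..1}; dist t s < d\<rbrakk> \<Longrightarrow> dist (g t) (g s) < e / 2"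
    unfolding uniformly_continuous_on_def using e by (metis half_gt_zero)
  obtain n where n: "n > 0" "1 / real n < d" using d(1) by (metis nat_approx_posE zero_less_Suc)
  define p where "p i = g (real i / real n)" for i :: nat
  have near: "\<exists>j\<le>n. dist (p j) z < e / 2" if "z \<in> frontier D" for z
  proof -
    obtain s where s: "s \<in> {0..1}" "z = g s"
      using g(3) \<open>z \<in> frontier D\<close> unfolding path_image_def by blast
    define j where "j = nat \<lfloor>s * real n\<rfloor>"
    have j: "real j \<le> s * real n" "s * real n < real j + 1"
      using s(1) by (auto simp: j_def)
    have "s * real n \<le> real n" using s(1) n(1) by simp
    then have jn: "j \<le> n" using j(1) by linarith
    have "real j / real n \<le> s" "s \<le> real j / real n + 1 / real n"
      using j n(1) by (simp_all add: field_simps)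
    then have "dist (real j / real n) s \<le> 1 / real n" by (simp add: dist_real_def)
    then have "dist (g (real j / real n)) (g s) < e / 2"
      using n jn s(1) by (intro d(2)) auto
    then show ?thesis using jn s(2) by (auto simp: p_def)
  qed
  have far: "\<exists>j\<le>n. p j \<bullet> u \<ge> x \<bullet> u - e / 2" if "norm u = 1" "x \<in> D" for u x :: complex
  proof -
    obtain t where t: "t > 0" "x + t *\<^sub>R u \<in> frontier D"
      using ray_to_frontier[of D x u] D \<open>x \<in> D\<close> \<open>norm u = 1\<close> by (metis interior_open norm_zero zero_neq_one)
    obtain j where j: "j \<le> n" "dist (p j) (x + t *\<^sub>R u) < e / 2" using near[OF t(2)] by blast
    have "\<bar>(p j - (x + t *\<^sub>R u)) \<bullet> u\<bar> < e / 2"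
      using Cauchy_Schwarz_ineq2[of "p j - (x + t *\<^sub>R u)" u] j(2) \<open>norm u = 1\<close> by (simp add: dist_norm)
    moreover have "u \<bullet> u = 1" using \<open>norm u = 1\<close> by (simp add: dot_square_norm)
    ultimately have "p j \<bullet> u \<ge> x \<bullet> u - e / 2" using t(1)
      unfolding abs_less_iff by (simp add: inner_diff_left inner_add_left)
    then show ?thesis using j(1) by blast
  qed
  show ?thesis
  proof (rule that[OF n(1)])
    fix u x y :: complex assume u: "norm u = 1" and xy: "x \<in> D" "y \<in> D"
    obtain j where j: "j \<le> n" "p j \<bullet> u \<ge> x \<bullet> u - e / 2" using far[OF u xy(1)] by blast
    obtain k where k: "k \<le> n" "p k \<bullet> - u \<ge> y \<bullet> - u - e / 2" using far[of "- u"] u xy(2) by auto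
    have "p n = p 0" using g(2) n(1) by (simp add: p_def pathstart_def pathfinish_def)
    then have "2 * \<bar>p j \<bullet> u - p k \<bullet> u\<bar> \<le> (\<Sum>i<n. \<bar>p (Suc i) \<bullet> u - p i \<bullet> u\<bar>)"
      by (intro closed_polygon_variation_ge[of "\<lambda>i. p i \<bullet> u"] j k) simp
    then show "(x - y) \<bullet> u \<le> (\<Sum>i<n. \<bar>(g (real (Suc i) / real n) - g (real i / real n)) \<bullet> u\<bar>) / 2 + e"
      using j k unfolding p_def[symmetric] by (simp add: inner_diff_left abs_if split: if_splits)
  qed
qed

text \<open>On either side of the interior point \<open>q\<close> the line meets the frontier at
  most once: a point strictly between \<open>q\<close> and a frontier point is interior by
  convexity. Hence the sign of the position relative to \<open>q\<close> determines the frontier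
  point.\<close>

lemma card_frontier_Int_line_le_2:
  fixes D :: "complex set" and u :: complex
  assumes D: "open D" "convex D" "q \<in> D" and u: "u \<noteq> 0"
  shows "finite {x \<in> frontier D. u \<bullet> x = u \<bullet> q} \<and> card {x \<in> frontier D. u \<bullet> x = u \<bullet> q} \<le> 2"
proof -
  let ?X = "{x \<in> frontier D. u \<bullet> x = u \<bullet> q}"
  \<comment> \<open>The coordinate of x on the line through \<open>q\<close> in direction
    \<open>\<i> * u\<close>, which is perpendicular to \<open>u\<close>.\<close>
  define \<tau> where "\<tau> x = ((\<i> * u) \<bullet> (x - q)) / (norm u)\<^sup>2" for x
  have par: "x = q + \<tau> x *\<^sub>R (\<i> * u)" if "x \<in> ?X" for x
  proof -
    have z: "u \<bullet> (x - q) = 0" using that by (simp add: inner_diff_right)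
    have nz: "(Re u)\<^sup>2 + (Im u)\<^sup>2 \<noteq> 0" using u by (simp add: complex_eq_iff)
    have r: "(Re u)\<^sup>2 * Re (x - q) = - Re u * Im u * Im (x - q)" "(Im u)\<^sup>2 * Im (x - q) = - Re u * Im u * Re (x - q)"
      using z unfolding inner_complex_def power2_eq_square by algebra+
    have "x - q = \<tau> x *\<^sub>R (\<i> * u)"
      using nz r unfolding \<tau>_def cmod_power2 inner_complex_def
      by (auto simp: complex_eq_iff field_simps power2_eq_square)
    then show ?thesis by (simp add: algebra_simps)
  qed
  have fD: "x \<notin> D" "x \<in> closure D" if "x \<in> ?X" for x
    using that D(1) by (auto simp: frontier_def interior_open)
  have no: False if x: "x \<in> ?X" and y: "y \<in> ?X" and r: "0 < r" "r < 1" "\<tau> x = r * \<tau> y" for x y r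
  proof -
    have "x = (1 - r) *\<^sub>R q + r *\<^sub>R y"
    proof -
      have "(1 - r) *\<^sub>R q + r *\<^sub>R (q + \<tau> y *\<^sub>R (\<i> * u)) = q + \<tau> x *\<^sub>R (\<i> * u)"
        by (simp add: r(3) algebra_simps)
      then show ?thesis using par[OF x] par[OF y] by metis
    qed
    moreover have "q \<noteq> y" using fD[OF y] D(3) by auto
    ultimately have "x \<in> open_segment q y" using r by (auto simp: in_segment)
    then show False
      using in_interior_closure_convex_segment[OF D(2), of q y] fD[OF x] fD[OF y] D by (auto simp: interior_open)
  qed
  have nz: "\<tau> x \<noteq> 0" if "x \<in> ?X" for x using par[OF that] fD[OF that] D(3) by auto
  have "inj_on (\<lambda>x. sgn (\<tau> x)) ?X"
  proof (rule inj_onI, rule ccontr)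
    fix x y assume x: "x \<in> ?X" and y: "y \<in> ?X" and s: "sgn (\<tau> x) = sgn (\<tau> y)" and "x \<noteq> y"
    have "\<tau> x \<noteq> \<tau> y" using par[OF x] par[OF y] \<open>x \<noteq> y\<close> by metis
    then have "0 < \<tau> x / \<tau> y \<and> \<tau> x / \<tau> y < 1 \<or> 0 < \<tau> y / \<tau> x \<and> \<tau> y / \<tau> x < 1"
      using s nz[OF x] nz[OF y] by (auto simp: sgn_if field_simps split: if_splits)
    then show False
      using no[OF x y, of "\<tau> x / \<tau> y"] no[OF y x, of "\<tau> y / \<tau> x"] nz[OF x] nz[OF y] by auto
  qed
  moreover have "(\<lambda>x. sgn (\<tau> x)) ` ?X \<subseteq> {-1, 1}" using nz by (auto simp: sgn_if)
  ultimately show ?thesis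
    using card_inj_on_le[of _ ?X "{-1, 1::real}"] inj_on_finite[of _ ?X "{-1, 1::real}"]
    by (auto simp: numeral_2_eq_2)
qed

text \<open>Banach's indicatrix: almost every level line of a linear functional meets the loop
  at most twice, so the functional has variation at most twice its oscillation.\<close>
lemma frontier_loop_linear_variation_le:
  fixes D :: "complex set" and u :: complex
  assumes D: "open D" "convex D" and g: "simple_path g" "path_image g = frontier D" and u: "u \<noteq> 0"
    and B: "\<And>x. x \<in> frontier D \<Longrightarrow> \<bar>u \<bullet> x\<bar> \<le> B"
    and t: "t 0 = 0" "t n = 1" "\<And>i. i < n \<Longrightarrow> t i \<le> t (Suc i)"
  shows "(\<Sum>i<n. \<bar>u \<bullet> g (t (Suc i)) - u \<bullet> g (t i)\<bar>) \<le> 4 * B"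
proof -
  define U where "U s = u \<bullet> g s" for s
  have tmono: "t i \<le> t j" if "i \<le> j" "j \<le> n" for i j
    using that by (induction j rule: dec_induct) (use t(3) in \<open>auto intro: order_trans simp: less_eq_Suc_le\<close>)
  have t01: "t i \<in> {0..1}" if "i \<le> n" for i
    using tmono[of 0 i] tmono[of i n] t(1,2) that by auto
  have gf: "g s \<in> frontier D" if "s \<in> {0..1}" for s using g(2) that by (auto simp: path_image_def)
  have UB: "\<bar>U s\<bar> \<le> B" if "s \<in> {0..1}" for s using B gf[OF that] by (auto simp: U_def)
  have B0: "B \<ge> 0" using UB[of 0] by auto
  have contU: "continuous_on {0..1} U"
    using g(1) unfolding U_def by (auto simp: simple_path_def path_def intro!: continuous_intros)
  \<comment> \<open>The levels strictly between the two endpoint values; the length of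
    \<open>I i\<close> is the i-th term of the variation.\<close>
  define I where "I i = {min (U (t i)) (U (t (Suc i)))<..<max (U (t i)) (U (t (Suc i)))}" for i
  have two: "card {i. i < n \<and> s \<in> I i} \<le> 2" for s
  proof (cases "{i. i < n \<and> s \<in> I i} = {}")
    case False
    let ?J = "{i. i < n \<and> s \<in> I i}"
    \<comment> \<open>Since the level is strictly between the endpoint values, the intermediate
      value theorem gives a parameter strictly inside the subinterval. Different subintervals
      therefore give different parameters.\<close>
    have "\<exists>\<tau>. t i < \<tau> \<and> \<tau> < t (Suc i) \<and> U \<tau> = s" if i: "i \<in> ?J" for i
    proof -
      have le: "t i \<le> t (Suc i)" using t(3) i by simp
      have "continuous_on {t i..t (Suc i)} U"
        using t01[of i] t01[of "Suc i"] i by (intro continuous_on_subset[OF contU]) auto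
      then obtain \<tau> where "\<tau> \<ge> t i" "\<tau> \<le> t (Suc i)" "U \<tau> = s"
        using IVT'[of U "t i" s "t (Suc i)"] IVT2'[of U "t (Suc i)" s "t i"] i le
        by (auto simp: I_def min_def max_def split: if_splits)
      moreover from this have "\<tau> \<noteq> t i" "\<tau> \<noteq> t (Suc i)" using i by (auto simp: I_def)
      ultimately show ?thesis by (intro exI[of _ \<tau>]) auto
    qed
    then obtain \<tau> where \<tau>: "\<And>i. i \<in> ?J \<Longrightarrow> t i < \<tau> i \<and> \<tau> i < t (Suc i) \<and> U (\<tau> i) = s" by metis
    have \<tau>01: "\<tau> i \<in> {0<..<1}" if "i \<in> ?J" for i
      using \<tau>[OF that] t01[of i] t01[of "Suc i"] that by auto
    have lt: "\<tau> i < \<tau> j" if "i \<in> ?J" "j \<in> ?J" "i < j" for i j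
      using \<tau>[OF that(1)] \<tau>[OF that(2)] tmono[of "Suc i" j] that by auto
    have "inj_on \<tau> ?J" by (rule inj_onI) (metis lt less_irrefl linorder_neqE_nat)
    \<comment> \<open>The parameters avoid 0 and 1, the only pair at which a simple path may repeat
      a value.\<close>
    moreover have "inj_on g (\<tau> ` ?J)"
      using simple_path_inj_on[OF g(1)] \<tau>01 by (rule_tac inj_on_subset) auto
    ultimately have inj: "inj_on (g \<circ> \<tau>) ?J" by (rule comp_inj_on)
    obtain i where i: "i \<in> ?J" using False by blast
    \<comment> \<open>The bound of two needs a level line through a point of D. Closure points on
      both sides of the level are approximated from D, and connectedness of D then gives
      \<open>q\<close> on it.\<close>
    obtain a b where ab: "a \<in> closure D" "b \<in> closure D" "u \<bullet> a < s" "s < u \<bullet> b"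
    proof -
      have "g (t i) \<in> closure D" "g (t (Suc i)) \<in> closure D"
        using gf[OF t01[of i]] gf[OF t01[of "Suc i"]] i by (auto simp: frontier_def)
      then show ?thesis
        using that[of "g (t i)" "g (t (Suc i))"] that[of "g (t (Suc i))" "g (t i)"] i
        by (auto simp: I_def U_def min_def max_def split: if_splits)
    qed
    obtain a' where a': "a' \<in> D" "u \<bullet> a' < s"
      using open_Int_closure_eq_empty[OF open_halfspace_lt[of u s], of D] ab by blast
    obtain b' where b': "b' \<in> D" "s < u \<bullet> b'"
      using open_Int_closure_eq_empty[OF open_halfspace_gt[of s u], of D] ab by blast
    obtain q where q: "q \<in> D" "u \<bullet> q = s"
      using connected_ivt_hyperplane[OF convex_connected[OF D(2)] a'(1) b'(1), of u s] a' b' by auto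
    have "(g \<circ> \<tau>) ` ?J \<subseteq> {x \<in> frontier D. u \<bullet> x = u \<bullet> q}"
    proof
      fix y assume "y \<in> (g \<circ> \<tau>) ` ?J"
      then obtain i where i: "i \<in> ?J" "y = g (\<tau> i)" by auto
      have "g (\<tau> i) \<in> frontier D" using \<tau>01[OF i(1)] by (intro gf) auto
      then show "y \<in> {x \<in> frontier D. u \<bullet> x = u \<bullet> q}" using \<tau>[OF i(1)] i(2) q(2) by (simp add: U_def)
    qed
    from card_inj_on_le[OF inj this] show ?thesis
      using card_frontier_Int_line_le_2[OF D q(1) u] by linarith
  next
    case True
    then show ?thesis by (metis card.empty zero_le)
  qed
  have meas: "(\<integral>s. indicator (I i) s \<partial>lborel) = \<bar>U (t (Suc i)) - U (t i)\<bar>" for i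
    by (auto simp: I_def min_def max_def)
  have int: "integrable lborel (indicator (I i) :: real \<Rightarrow> real)" for i
    by (auto simp: I_def integrable_indicator_iff)
  \<comment> \<open>The variation is the integral over levels s of the number of intervals
    \<open>I i\<close> containing s. This count is at most 2 and vanishes outside [-B, B], whence
    \<open>4 * B\<close>.\<close>
  have "(\<Sum>i<n. \<bar>U (t (Suc i)) - U (t i)\<bar>) = (\<integral>s. (\<Sum>i<n. indicator (I i) s) \<partial>lborel)"
    by (subst Bochner_Integration.integral_sum) (simp_all only: meas int)
  also have "\<dots> \<le> (\<integral>s. 2 * indicator {-B..B} s \<partial>lborel)"
  proof (rule integral_mono)
    fix s :: real
    have "(\<Sum>i<n. indicator (I i) s :: real) = real (card {i. i < n \<and> s \<in> I i})"
      by (simp add: indicator_def sum.If_cases Int_def)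
    also have "\<dots> \<le> 2 * indicator {-B..B} s"
    proof (cases "s \<in> {-B..B}")
      case False
      have "s \<notin> I i" if "i < n" for i
        using UB[OF t01[of i]] UB[OF t01[of "Suc i"]] False that
        by (auto simp: I_def min_def max_def abs_le_iff split: if_splits)
      then have "{i. i < n \<and> s \<in> I i} = {}" by auto
      then show ?thesis by (simp only: card.empty) simp
    qed (use two[of s] in auto)
    finally show "(\<Sum>i<n. indicator (I i) s :: real) \<le> 2 * indicator {-B..B} s" .
  qed (auto intro!: integrable_sum int simp: integrable_indicator_iff emeasure_lborel_Icc_eq)
  also have "\<dots> = 4 * B" using B0 by simp
  finally show ?thesis by (simp add: U_def)
qed

text \<open>An increment is no longer than the sum of its horizontal and vertical parts, and each
  coordinate has variation at most \<open>4 * B\<close>. Boundedness is what makes the real supremum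
  in \<open>curve_length\<close> an upper bound for the polygon lengths.\<close>

lemma frontier_loop_rectifiable:
  fixes D :: "complex set"
  assumes D: "open D" "convex D" "bounded D" and g: "simple_path g" "path_image g = frontier D"
  shows "bdd_above {(\<Sum>i<n. norm (g (t (Suc i)) - g (t i))) | n t.
      t 0 = 0 \<and> t n = 1 \<and> (\<forall>i<n. t i \<le> t (Suc i))}"
proof -
  obtain B where B: "\<And>x. x \<in> frontier D \<Longrightarrow> norm x \<le> B"
    using bounded_closure[OF D(3)] by (auto simp: bounded_iff frontier_def)
  have b1: "\<bar>1 \<bullet> x\<bar> \<le> B" and b2: "\<bar>\<i> \<bullet> x\<bar> \<le> B" if "x \<in> frontier D" for x
    using B[OF that] Cauchy_Schwarz_ineq2[of 1 x] Cauchy_Schwarz_ineq2[of \<i> x] by auto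
  have "(\<Sum>i<n. norm (g (t (Suc i)) - g (t i))) \<le> 8 * B"
    if t: "t 0 = 0" "t n = 1" "\<forall>i<n. t i \<le> t (Suc i)" for n t
  proof -
    have "(\<Sum>i<n. norm (g (t (Suc i)) - g (t i))) \<le>
      (\<Sum>i<n. \<bar>1 \<bullet> g (t (Suc i)) - 1 \<bullet> g (t i)\<bar> + \<bar>\<i> \<bullet> g (t (Suc i)) - \<i> \<bullet> g (t i)\<bar>)"
      by (intro sum_mono) (use cmod_le[of "g (t (Suc _)) - g (t _)"] in \<open>simp add: inner_complex_def\<close>)
    also have "\<dots> = (\<Sum>i<n. \<bar>1 \<bullet> g (t (Suc i)) - 1 \<bullet> g (t i)\<bar>) + (\<Sum>i<n. \<bar>\<i> \<bullet> g (t (Suc i)) - \<i> \<bullet> g (t i)\<bar>)"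
      by (rule sum.distrib)
    also have "\<dots> \<le> 4 * B + 4 * B"
      by (intro add_mono frontier_loop_linear_variation_le[OF D(1,2) g] b1 b2) (use t in auto)
    finally show ?thesis by simp
  qed
  then show ?thesis by (intro bdd_aboveI[of _ "8 * B"]) blast
qed

text \<open>The frontier is homeomorphic to the unit circle, whose standard parametrization is
  transported. This ensures that the choice in \<open>perimeter\<close> picks the length of an
  actual boundary loop.\<close>

lemma convex_frontier_simple_loop:
  fixes D :: "complex set"
  assumes D: "open D" "convex D" "bounded D" "D \<noteq> {}"
  obtains g where "simple_path g" "pathstart g = pathfinish g" "path_image g = frontier D"
proof -
  have "rel_frontier (ball (0::complex) 1) homeomorphic rel_frontier D"
    by (rule homeomorphic_rel_frontiers_convex_bounded_sets)
      (use D in \<open>auto simp: aff_dim_open\<close>)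
  moreover have "rel_frontier (ball (0::complex) 1) = sphere 0 1"
    by (simp add: rel_frontier_nonempty_interior)
  moreover have "rel_frontier D = frontier D"
    using D by (simp add: rel_frontier_nonempty_interior interior_open)
  ultimately obtain k k' where hom: "homeomorphism (sphere (0::complex) 1) (frontier D) k k'"
    unfolding homeomorphic_def by auto
  show ?thesis
  proof (rule that[of "k \<circ> circlepath 0 1"])
    show "simple_path (k \<circ> circlepath 0 1)"
      using hom by (intro simple_path_continuous_image)
        (auto simp: simple_path_circlepath homeomorphism_def intro: inj_on_inverseI)
    show "path_image (k \<circ> circlepath 0 1) = frontier D"
      using hom by (simp add: path_image_compose homeomorphism_def)
    show "pathstart (k \<circ> circlepath 0 1) = pathfinish (k \<circ> circlepath 0 1)"
      by (simp add: pathstart_compose pathfinish_compose)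
  qed
qed

text \<open>Every loop that \<^const>\<open>perimeter\<close> may choose is rectifiable, so its polygons are no longer
  than \<^term>\<open>perimeter D\<close>.\<close>
lemma perimeter_width_bound:
  fixes D :: "complex set"
  assumes D: "open D" "convex D" "bounded D" "D \<noteq> {}" and e: "e > 0"
  obtains n :: nat and v :: "nat \<Rightarrow> complex" where "(\<Sum>i<n. norm (v i)) \<le> perimeter D"
    "\<And>u x y :: complex. \<lbrakk>norm u = 1; x \<in> D; y \<in> D\<rbrakk> \<Longrightarrow> (x - y) \<bullet> u \<le> (\<Sum>i<n. \<bar>v i \<bullet> u\<bar>) / 2 + e"
proof -
  have "\<exists>L g. simple_path g \<and> pathstart g = pathfinish g \<and> path_image g = frontier D \<and> curve_length g = L"
    using convex_frontier_simple_loop[OF D] by metis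
  from someI_ex[OF this] obtain g where g: "simple_path g" "pathstart g = pathfinish g"
    "path_image g = frontier D" and L: "curve_length g = perimeter D"
    unfolding perimeter_def by blast
  obtain n where n: "n > 0" "\<And>u x y :: complex. \<lbrakk>norm u = 1; x \<in> D; y \<in> D\<rbrakk> \<Longrightarrow>
    (x - y) \<bullet> u \<le> (\<Sum>i<n. \<bar>(g (real (Suc i) / real n) - g (real i / real n)) \<bullet> u\<bar>) / 2 + e"
    using frontier_loop_polygon_width[OF D(1,3) simple_path_imp_path[OF g(1)] g(2,3) e] by blast
  \<comment> \<open>The equally spaced partition is one of those competing in the supremum that
    defines \<open>curve_length\<close>.\<close>
  have "(\<Sum>i<n. norm (g (real (Suc i) / real n) - g (real i / real n))) \<le> curve_length g"
    unfolding curve_length_def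
    by (rule cSup_upper[OF _ frontier_loop_rectifiable[OF D(1-3) g(1,3)]])
      (use n(1) in \<open>auto simp: divide_right_mono intro!: exI[of _ n] exI[of _ "\<lambda>i. real i / real n"]\<close>)
  with n(2) show ?thesis unfolding L by (rule that[rotated])
qed

section \<open>Derivative estimates\<close>

text \<open>Cauchy's formula for the derivative at 0, rescaled; on the unit circle the conjugate is
  the inverse, which turns the Cauchy kernel into the Fourier factor.\<close>

lemma circle_coefficient_has_integral:
  assumes h: "h holomorphic_on ball 0 1" and r: "0 < r" "r < 1"
  shows "((\<lambda>t. h (of_real r * exp (2 * of_real pi * \<i> * of_real t)) *
      cnj (exp (2 * of_real pi * \<i> * of_real t))) has_integral of_real r * deriv h 0) {0..1}"
proof -
  let ?E = "\<lambda>t::real. exp (2 * of_real pi * \<i> * of_real t)"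
  have "((\<lambda>u. h u / (u - 0) ^ Suc 1) has_contour_integral (2 * pi * \<i>) / fact 1 * (deriv ^^ 1) h 0) (circlepath 0 r)"
    using r by (intro Cauchy_has_contour_integral_higher_derivative_circlepath)
      (auto intro!: holomorphic_on_subset[OF h] holomorphic_on_imp_continuous_on)
  then have "((\<lambda>t. h (circlepath 0 r t) / circlepath 0 r t ^ 2 * (2 * pi * \<i> * r * ?E t)) has_integral 2 * pi * \<i> * deriv h 0) {0..1}"
    unfolding has_contour_integral vector_derivative_circlepath by (simp add: power2_eq_square)
  from has_integral_mult_right[OF this, of "of_real r / (2 * pi * \<i>)"]
  have "((\<lambda>t. of_real r / (2 * pi * \<i>) * (h (circlepath 0 r t) / circlepath 0 r t ^ 2 * (2 * pi * \<i> * r * ?E t))) has_integral of_real r * deriv h 0) {0..1}"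
    by (simp add: field_simps)
  then show ?thesis
  proof (rule has_integral_eq[rotated])
    fix t :: real
    have "cnj (?E t) = inverse (?E t)" by (simp add: exp_cnj exp_minus[symmetric])
    then show "of_real r / (2 * pi * \<i>) * (h (circlepath 0 r t) / circlepath 0 r t ^ 2 * (2 * pi * \<i> * r * ?E t)) =
        h (of_real r * ?E t) * cnj (?E t)"
      using r by (simp add: circlepath power2_eq_square field_simps)
  qed
qed

text \<open>Cauchy's theorem on the circle. After conjugation it removes the antiholomorphic part
  from the first Fourier coefficient of a harmonic map.\<close>

lemma circle_negative_coefficient_has_integral:
  assumes g: "g holomorphic_on ball 0 1" and r: "0 < r" "r < 1"
  shows "((\<lambda>t. g (of_real r * exp (2 * of_real pi * \<i> * of_real t)) *
      exp (2 * of_real pi * \<i> * of_real t)) has_integral 0) {0..1}"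
proof -
  let ?E = "\<lambda>t::real. exp (2 * of_real pi * \<i> * of_real t)"
  have "(g has_contour_integral 0) (circlepath 0 r)"
    using r by (intro Cauchy_theorem_convex_simple[OF g]) auto
  then have "((\<lambda>t. g (circlepath 0 r t) * (2 * pi * \<i> * r * ?E t)) has_integral 0) {0..1}"
    unfolding has_contour_integral vector_derivative_circlepath by simp
  from has_integral_mult_right[OF this, of "1 / (2 * pi * \<i> * r)"]
  have "((\<lambda>t. 1 / (2 * pi * \<i> * r) * (g (circlepath 0 r t) * (2 * pi * \<i> * r * ?E t))) has_integral 0) {0..1}"
    by simp
  then show ?thesis
    by (rule has_integral_eq[rotated]) (use r in \<open>simp add: circlepath field_simps\<close>)
qed

text \<open>The estimate covers maps whose differential at 0 is not conformal, as happens after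
  recentring a conformal map at another point of the disc.\<close>

lemma norm_deriv_le_perimeter:
  fixes D :: "complex set"
  assumes D: "open D" "convex D" "bounded D" "D \<noteq> {}"
    and h: "h holomorphic_on ball 0 1" and g: "g holomorphic_on ball 0 1"
    and im: "\<And>z. z \<in> ball 0 1 \<Longrightarrow> h z + cnj (g z) \<in> D"
  shows "norm (deriv h 0) \<le> perimeter D / (2 * pi)"
proof -
  let ?E = "\<lambda>t::real. exp (2 * of_real pi * \<i> * of_real t)"
  define c where "c = deriv h 0"
  \<comment> \<open>A rotation making the coefficient real and nonnegative; the value 1 at c = 0
    keeps \<open>w\<close> a unit vector.\<close>
  define w where "w = (if c = 0 then 1 else sgn c)"
  have w: "norm w = 1" by (simp add: w_def norm_sgn)
  have wc: "cnj w * c = of_real (norm c)"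
    using complex_norm_square[of c] by (auto simp: w_def sgn_eq field_simps power2_eq_square)
  \<comment> \<open>Differences at antipodal points turn values of the map into chords of D, which
    its widths bound. They also double the derivative at 0.\<close>
  define H where "H z = h z - h (- z)" for z
  define G where "G z = g z - g (- z)" for z
  have hm: "(\<lambda>z. k (- z)) holomorphic_on ball 0 1" if "k holomorphic_on ball 0 1" for k :: "complex \<Rightarrow> complex"
    by (rule holomorphic_on_compose_gen[of "\<lambda>z. - z", OF _ that, unfolded o_def]) (auto intro!: holomorphic_intros)
  have H: "H holomorphic_on ball 0 1" and G: "G holomorphic_on ball 0 1"
    unfolding H_def G_def by (intro holomorphic_on_diff h g hm)+
  have h0: "(h has_field_derivative c) (at 0)"
    unfolding c_def by (rule holomorphic_derivI[OF h]) auto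
  have "(H has_field_derivative c - c * (- 1)) (at 0)"
    unfolding H_def
    by (rule derivative_intros h0 DERIV_chain2[where f=h and g=uminus])+ (use h0 in \<open>auto intro!: derivative_eq_intros\<close>)
  then have dH: "deriv H 0 = 2 * c" by (auto dest: DERIV_imp_deriv)
  have "r * norm c \<le> perimeter D / (2 * pi)" if r: "0 < r" "r < 1" for r
  proof (rule field_le_epsilon)
    fix e :: real assume e: "e > 0"
    obtain n and v :: "nat \<Rightarrow> complex" where v: "(\<Sum>i<n. norm (v i)) \<le> perimeter D"
      "\<And>u x y. \<lbrakk>norm u = 1; x \<in> D; y \<in> D\<rbrakk> \<Longrightarrow> (x - y) \<bullet> u \<le> (\<Sum>i<n. \<bar>v i \<bullet> u\<bar>) / 2 + e"
      using perimeter_width_bound[OF D e] by metis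
    let ?f = "\<lambda>z. h z + cnj (g z)"
    let ?z = "\<lambda>t. of_real r * ?E t"
    have "((\<lambda>t. cnj w * (H (?z t) * cnj (?E t)) + cnj w * cnj (G (?z t) * ?E t)) has_integral
        cnj w * (of_real r * deriv H 0) + cnj w * cnj 0) {0..1}"
      using has_integral_cnj[THEN iffD2, OF circle_negative_coefficient_has_integral[OF G r], unfolded o_def]
      by (intro has_integral_add has_integral_mult_right circle_coefficient_has_integral[OF H r])
    from has_integral_linear[OF this bounded_linear_Re]
    have "((\<lambda>t. (?f (?z t) - ?f (- ?z t)) \<bullet> (w * ?E t)) has_integral 2 * r * norm c) {0..1}"
    proof (rule has_integral_eq_rhs[OF has_integral_eq[rotated]])
      show "(Re \<circ> (\<lambda>t. cnj w * (H (?z t) * cnj (?E t)) + cnj w * cnj (G (?z t) * ?E t))) t =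
          (?f (?z t) - ?f (- ?z t)) \<bullet> (w * ?E t)" for t
        by (simp add: H_def G_def inner_complex_def algebra_simps)
      have "cnj w * (of_real r * deriv H 0) = of_real (2 * r * norm c)"
        using wc by (simp add: dH mult_ac)
      then show "2 * r * norm c = Re (cnj w * (of_real r * deriv H 0) + cnj w * cnj 0)"
        by (simp only: complex_cnj_zero mult_zero_right add_0_right Re_complex_of_real)
    qed
    \<comment> \<open>Averaging the width bound over all directions gives half of 2/pi times the
      polygon length, plus \<open>e\<close>.\<close>
    moreover have "((\<lambda>t. (\<Sum>i<n. \<bar>v i \<bullet> (w * ?E t)\<bar>) / 2 + e) has_integral (\<Sum>i<n. 2 / pi * norm (v i)) / 2 + e) {0..1}"
    proof (intro has_integral_add has_integral_divide)
      show "((\<lambda>t. \<Sum>i<n. \<bar>v i \<bullet> (w * ?E t)\<bar>) has_integral (\<Sum>i<n. 2 / pi * norm (v i))) {0..1}"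
        by (rule has_integral_sum[OF finite_lessThan abs_inner_circle_has_integral[OF w]])
      show "((\<lambda>t. e) has_integral e) {0..1::real}" using has_integral_const_real[of e 0 1] by simp
    qed
    moreover have "(?f (?z t) - ?f (- ?z t)) \<bullet> (w * ?E t) \<le> (\<Sum>i<n. \<bar>v i \<bullet> (w * ?E t)\<bar>) / 2 + e" for t
      by (intro v(2) im) (use r w in \<open>auto simp: norm_mult\<close>)
    ultimately have "2 * r * norm c \<le> (\<Sum>i<n. 2 / pi * norm (v i)) / 2 + e"
      by (rule has_integral_le)
    also have "\<dots> = (\<Sum>i<n. norm (v i)) / pi + e" 
      unfolding sum_distrib_left[symmetric] by simp
    also have "\<dots> \<le> perimeter D / pi + e" using v(1) by (simp add: divide_right_mono)
    finally have "2 * (r * norm c) \<le> perimeter D / pi + e" by (simp add: mult.assoc)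
    moreover have "perimeter D / (2 * pi) = perimeter D / pi / 2" by simp
    ultimately show "r * norm c \<le> perimeter D / (2 * pi) + e" using e by linarith
  qed
  then show ?thesis unfolding c_def[symmetric] by (rule field_le_mult_one_interval)
qed

text \<open>The affine map \<open>T\<close> sends the unit disc onto the disc of radius 1 - |z|
  about z. Applying the central estimate after composing with \<open>T\<close> brings in that radius
  as a factor.\<close>

lemma norm_deriv_le_perimeter_within:
  fixes D :: "complex set"
  assumes D: "open D" "convex D" "bounded D" "D \<noteq> {}"
    and h: "h holomorphic_on ball 0 1" and g: "g holomorphic_on ball 0 1"
    and im: "\<And>z. z \<in> ball 0 1 \<Longrightarrow> h z + cnj (g z) \<in> D" and z: "z \<in> ball 0 1"
  shows "norm (deriv h z) * (1 - norm z) \<le> perimeter D / (2 * pi)"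
proof -
  define \<rho> where "\<rho> = 1 - norm z"
  have \<rho>: "\<rho> > 0" using z by (simp add: \<rho>_def)
  define T where "T x = z + of_real \<rho> * x" for x
  have T: "T ` ball 0 1 \<subseteq> ball 0 1"
  proof clarsimp
    fix x :: complex assume "norm x < 1"
    have "norm (T x) \<le> norm z + \<rho> * norm x"
      unfolding T_def using norm_triangle_ineq[of z "of_real \<rho> * x"] \<rho> by (simp add: norm_mult)
    also have "\<dots> < norm z + \<rho> * 1" using \<rho> \<open>norm x < 1\<close> by simp
    finally show "norm (T x) < 1" by (simp add: \<rho>_def)
  qed
  have "T holomorphic_on ball 0 1" unfolding T_def by (intro holomorphic_intros)
  then have hT: "(h \<circ> T) holomorphic_on ball 0 1" "(g \<circ> T) holomorphic_on ball 0 1"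
    using T h g by (auto intro: holomorphic_on_compose_gen)
  have "(h has_field_derivative deriv h z) (at (T 0))"
    using holomorphic_derivI[OF h _ z] by (simp add: T_def)
  moreover have "(T has_field_derivative of_real \<rho>) (at 0)"
    unfolding T_def by (auto intro!: derivative_eq_intros)
  ultimately have "((h \<circ> T) has_field_derivative deriv h z * of_real \<rho>) (at 0)"
    by (rule DERIV_chain)
  then have "deriv (h \<circ> T) 0 = deriv h z * of_real \<rho>" by (rule DERIV_imp_deriv)
  moreover have "norm (deriv (h \<circ> T) 0) \<le> perimeter D / (2 * pi)"
    by (rule norm_deriv_le_perimeter[OF D hT]) (use im T in \<open>auto simp: image_subset_iff\<close>)
  ultimately show ?thesis using \<rho> by (simp add: norm_mult \<rho>_def[symmetric])
qed

section \<open>Local boundedness and the maximum principle\<close>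

lemma compact_subset_unit_disc:
  fixes K :: "complex set"
  assumes "compact K" "K \<subseteq> ball 0 1"
  obtains s where "0 \<le> s" "s < 1" "K \<subseteq> cball 0 s"
proof (cases "K = {}")
  case True
  then show ?thesis using that[of 0] by auto
next
  case False
  then obtain x where "x \<in> K" "\<forall>y\<in>K. norm y \<le> norm x"
    using continuous_attains_sup[OF assms(1), of norm] by (auto intro: continuous_intros)
  then show ?thesis using assms(2) by (intro that[of "norm x"]) auto
qed

text \<open>On a disc of radius s < 1 the derivatives are bounded by |C| / (1 - s), and all
  functions share the value \<open>a\<close> at 0, so the mean value inequality bounds them
  uniformly. This is the hypothesis of Montel's theorem.\<close>

lemma holomorphic_bounded_on_compacts:
  assumes dh: "\<And>h z. \<lbrakk>h \<in> \<H>; z \<in> ball 0 1\<rbrakk> \<Longrightarrow> norm (deriv h z) * (1 - norm z) \<le> C"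
    and h: "\<And>h. h \<in> \<H> \<Longrightarrow> h holomorphic_on ball 0 1" "\<And>h. h \<in> \<H> \<Longrightarrow> h 0 = a"
    and K: "compact K" "K \<subseteq> ball 0 1"
  shows "\<exists>B. \<forall>h\<in>\<H>. \<forall>z\<in>K. norm (h z) \<le> B"
proof -
  obtain s where s: "0 \<le> s" "s < 1" "K \<subseteq> cball 0 s" using compact_subset_unit_disc[OF K] by blast
  have "norm (h z) \<le> norm a + \<bar>C\<bar> / (1 - s)" if hH: "h \<in> \<H>" and z: "z \<in> K" for h z
  proof -
    have cb: "cball 0 s \<subseteq> ball (0::complex) 1" using s by auto
    have "norm (h z - h 0) \<le> (\<bar>C\<bar> / (1 - s)) * norm (z - 0)"
    proof (rule field_differentiable_bound[of "cball 0 s"])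
      fix x :: complex assume x: "x \<in> cball 0 s"
      show "(h has_field_derivative deriv h x) (at x within cball 0 s)"
        using x cb by (intro holomorphic_derivI[OF h(1)[OF hH]]) auto
      have "norm (deriv h x) * (1 - s) \<le> norm (deriv h x) * (1 - norm x)"
        using x by (intro mult_left_mono) auto
      also have "\<dots> \<le> \<bar>C\<bar>" using dh[OF hH] x cb by force
      finally show "norm (deriv h x) \<le> \<bar>C\<bar> / (1 - s)" using s by (simp add: field_simps)
    qed (use s z in auto)
    also have "\<dots> \<le> (\<bar>C\<bar> / (1 - s)) * 1"
      using s z by (intro mult_left_mono) (auto intro: order_trans[of _ s])
    finally show ?thesis using h(2)[OF hH] norm_triangle_sub[of "h z" a] by simp
  qed
  then show ?thesis by blast
qed

text \<open>If the map touched the frontier at z, a supporting functional along it would be minimal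
  at z. That functional is minus the real part of a holomorphic \<open>F\<close>, so the modulus of
  exp F would be maximal at z and hence constant, against the strict inequality at
  \<open>a\<close>.\<close>

lemma harmonic_image_in_convex_interior:
  fixes D :: "complex set"
  assumes D: "open D" "convex D" and S: "open S" "connected S"
    and h: "h holomorphic_on S" and g: "g holomorphic_on S"
    and im: "\<And>z. z \<in> S \<Longrightarrow> h z + cnj (g z) \<in> closure D"
    and a: "a \<in> S" "h a + cnj (g a) \<in> D" and z: "z \<in> S"
  shows "h z + cnj (g z) \<in> D"
proof (rule ccontr)
  let ?f = "\<lambda>z. h z + cnj (g z)"
  assume "?f z \<notin> D"
  then obtain u where u: "\<And>y. y \<in> closure D \<Longrightarrow> u \<bullet> ?f z \<le> u \<bullet> y" "\<And>y. y \<in> D \<Longrightarrow> u \<bullet> ?f z < u \<bullet> y"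
    using supporting_hyperplane_relative_frontier[OF D(2) im[OF z]] rel_interior_open[OF D(1)] by metis
  define F where "F x = - (cnj u * h x + u * g x)" for x
  have F: "F holomorphic_on S" unfolding F_def by (intro holomorphic_intros h g)
  have ReF: "Re (F x) = - (u \<bullet> ?f x)" for x
    by (simp add: F_def inner_complex_def algebra_simps)
  have "(\<lambda>x. exp (F x)) constant_on S"
  proof (rule maximum_modulus_principle[OF _ S S(1) subset_refl z])
    show "(\<lambda>x. exp (F x)) holomorphic_on S" by (intro holomorphic_intros F)
    show "norm (exp (F x)) \<le> norm (exp (F z))" if "x \<in> S" for x
      using u(1)[OF im[OF that]] by (simp add: ReF)
  qed
  then have "norm (exp (F a)) = norm (exp (F z))" using a(1) z by (metis constant_on_def)
  then show False using u(2)[OF a(2)] by (simp add: ReF)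
qed

section \<open>Extremal maps\<close>

text \<open>Precomposition with complex conjugation exchanges the orientation preserving and the
  orientation reversing case, so the antiholomorphic part may be assumed to be critical at the centre.\<close>
definition conformal_pairs :: "complex set \<Rightarrow> complex \<Rightarrow> ((complex \<Rightarrow> complex) \<times> (complex \<Rightarrow> complex)) set" where
  "conformal_pairs D p = {(h, g). h holomorphic_on ball 0 1 \<and> g holomorphic_on ball 0 1 \<and>
     (\<forall>z\<in>ball 0 1. h z + cnj (g z) \<in> D) \<and> h 0 = p \<and> g 0 = 0 \<and> deriv g 0 = 0}"

section \<open>Conformal harmonic maps and normalized pairs\<close>

lemma onorm_complex_mult: "onorm (\<lambda>k. c * k :: complex) = norm c"
proof (rule antisym)
  show "onorm (\<lambda>k. c * k) \<le> norm c" by (rule onorm_le) (simp add: norm_mult)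
  show "norm c \<le> onorm (\<lambda>k. c * k)" using onorm[OF bounded_linear_mult_right[of c], of 1] by simp
qed

lemma onorm_complex_mult_cnj: "onorm (\<lambda>k. c * cnj k) = norm c"
proof (rule antisym)
  show "onorm (\<lambda>k. c * cnj k) \<le> norm c" by (rule onorm_le) (simp add: norm_mult)
  have "bounded_linear (\<lambda>k. c * cnj k)"
    by (intro bounded_linear_intros bounded_linear_cnj)
  from onorm[OF this, of 1] show "norm c \<le> onorm (\<lambda>k. c * cnj k)" by simp
qed

lemma conformal_pairs_imp_admissible:
  assumes "(h, g) \<in> conformal_pairs D p"
  shows "admissible D p (\<lambda>z. h z + cnj (g z))"
    and "onorm (frechet_derivative (\<lambda>z. h z + cnj (g z)) (at 0)) = norm (deriv h 0)"
proof -
  have *: "h holomorphic_on ball 0 1" "g holomorphic_on ball 0 1" "\<forall>z\<in>ball 0 1. h z + cnj (g z) \<in> D"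
    "h 0 = p" "g 0 = 0" "deriv g 0 = 0"
    using assms by (auto simp: conformal_pairs_def)
  have "(\<lambda>k. deriv h 0 * k + cnj (deriv g 0 * k)) = frechet_derivative (\<lambda>z. h z + cnj (g z)) (at 0)"
    by (intro frechet_derivative_at has_derivative_holomorphic_plus_cnj[OF open_ball *(1,2)]) simp
  then have fd: "frechet_derivative (\<lambda>z. h z + cnj (g z)) (at 0) = (\<lambda>k. deriv h 0 * k)"
    by (simp add: *(6))
  then show "onorm (frechet_derivative (\<lambda>z. h z + cnj (g z)) (at 0)) = norm (deriv h 0)"
    by (simp add: onorm_complex_mult)
  show "admissible D p (\<lambda>z. h z + cnj (g z))"
    using * harmonic_on_holomorphic_plus_cnj[OF open_ball *(1,2)]
    unfolding admissible_def conformal_linear_def fd by auto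
qed

text \<open>Moving the constant \<open>cnj (g 0)\<close> into the holomorphic part leaves the sum
  and both derivatives unchanged. It fixes the values at 0, as the compactness argument
  requires.\<close>

lemma conformal_pairs_normalize:
  assumes h: "h holomorphic_on ball 0 1" and g: "g holomorphic_on ball 0 1"
    and im: "\<And>z. z \<in> ball 0 1 \<Longrightarrow> h z + cnj (g z) \<in> D" and p: "h 0 + cnj (g 0) = p" and dg: "deriv g 0 = 0"
  shows "\<exists>h' g'. (h', g') \<in> conformal_pairs D p \<and> deriv h' 0 = deriv h 0"
proof (intro exI conjI)
  have "h field_differentiable at 0" "g field_differentiable at 0"
    using h g by (auto intro: holomorphic_on_imp_differentiable_at)
  then show "deriv (\<lambda>z. h z + cnj (g 0)) 0 = deriv h 0" and "(\<lambda>z. h z + cnj (g 0), \<lambda>z. g z - g 0) \<in> conformal_pairs D p"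
    unfolding conformal_pairs_def using assms by (auto intro!: holomorphic_intros)
qed

lemma admissible_imp_conformal_pairs:
  assumes f: "admissible D p f"
  shows "\<exists>h g. (h, g) \<in> conformal_pairs D p \<and> norm (deriv h 0) = onorm (frechet_derivative f (at 0))"
proof -
  have f': "harmonic_on (ball 0 1) f" "f ` ball 0 1 \<subseteq> D" "f 0 = p" "conformal_linear (frechet_derivative f (at 0))"
    using f by (auto simp: admissible_def)
  obtain h g where hg: "h holomorphic_on ball 0 1" "g holomorphic_on ball 0 1"
    and eq: "\<And>z. z \<in> ball 0 1 \<Longrightarrow> f z = h z + cnj (g z)"
    using harmonic_on_imp_holomorphic_decomposition[OF open_ball convex_ball f'(1)] by blast
  have im: "h z + cnj (g z) \<in> D" if "z \<in> ball 0 1" for z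
    using f'(2) that eq[OF that] by (metis image_subset_iff)
  have "(f has_derivative (\<lambda>k. deriv h 0 * k + cnj (deriv g 0 * k))) (at 0)"
    by (rule has_derivative_transform_within_open[OF has_derivative_holomorphic_plus_cnj[OF open_ball hg], of _ "ball 0 1"])
      (auto simp: eq)
  then have fd: "frechet_derivative f (at 0) = (\<lambda>k. deriv h 0 * k + cnj (deriv g 0 * k))"
    by (rule frechet_derivative_at[symmetric])
  from f'(4) obtain c where
    c: "(\<forall>k. deriv h 0 * k + cnj (deriv g 0 * k) = c * k) \<or> (\<forall>k. deriv h 0 * k + cnj (deriv g 0 * k) = c * cnj k)"
    unfolding conformal_linear_def fd by blast
  then show ?thesis
  proof
    assume "\<forall>k. deriv h 0 * k + cnj (deriv g 0 * k) = c * k"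
    \<comment> \<open>Evaluation at 1 and \<i> separates the complex linear part of the differential
      from the antilinear one.\<close>
    from spec[OF this, of 1] spec[OF this, of \<i>] have dg: "deriv g 0 = 0"
      by (auto simp: complex_eq_iff)
    have "onorm (frechet_derivative f (at 0)) = norm (deriv h 0)"
      unfolding fd dg by (simp add: onorm_complex_mult)
    then show ?thesis
      using conformal_pairs_normalize[OF hg im _ dg, of p] eq[of 0] f'(3) by auto
  next
    assume "\<forall>k. deriv h 0 * k + cnj (deriv g 0 * k) = c * cnj k"
    from spec[OF this, of 1] spec[OF this, of \<i>] have dh: "deriv h 0 = 0"
      by (auto simp: complex_eq_iff)
    have on: "onorm (frechet_derivative f (at 0)) = norm (deriv g 0)"
      unfolding fd dh using onorm_complex_mult_cnj[of "cnj (deriv g 0)"] by simp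
    \<comment> \<open>These are the two parts of z |-> f(cnj z): conjugating the variable exchanges
      the roles of \<open>h\<close> and \<open>g\<close>.\<close>
    let ?h = "cnj \<circ> g \<circ> cnj" and ?g = "cnj \<circ> h \<circ> cnj"
    have "cnj ` ball 0 1 = ball 0 1" by (force simp: image_iff intro: bexI[of _ "cnj _"])
    then have hol: "?h holomorphic_on ball 0 1" "?g holomorphic_on ball 0 1"
      using hg by (auto intro!: holomorphic_on_compose_cnj_cnj)
    have "(h has_field_derivative deriv h 0) (at (cnj 0))" "(g has_field_derivative deriv g 0) (at (cnj 0))"
      using hg by (auto intro!: holomorphic_derivI)
    from this[THEN has_field_derivative_cnj_cnj, THEN DERIV_imp_deriv]
    have d: "deriv ?g 0 = 0" "deriv ?h 0 = cnj (deriv g 0)" by (simp_all add: dh)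
    have im': "?h z + cnj (?g z) \<in> D" if "z \<in> ball 0 1" for z
      using im[of "cnj z"] that by (simp add: add.commute)
    have "?h 0 + cnj (?g 0) = p" using eq[of 0] f'(3) by (simp add: add.commute)
    from conformal_pairs_normalize[OF hol im' this d(1)] show ?thesis unfolding on d(2) by auto
  qed
qed

text \<open>Normal families: both components converge locally uniformly along a subsequence, which
  preserves the normalization at 0 and the derivatives there. Only membership of the values in D
  needs a further argument.\<close>

lemma conformal_pairs_extremal:
  fixes D :: "complex set"
  assumes D: "open D" "convex D" "bounded D" and p: "p \<in> D"
    and x: "\<And>n. x n \<in> (\<lambda>(h, g). norm (deriv h 0)) ` conformal_pairs D p" "x \<longlonglongrightarrow> L"
  shows "L \<in> (\<lambda>(h, g). norm (deriv h 0)) ` conformal_pairs D p"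
proof -
  have ne: "D \<noteq> {}" using p by auto
  let ?B = "ball (0::complex) 1" and ?C = "perimeter D / (2 * pi)"
  obtain h g where hg: "\<And>n. (h n, g n) \<in> conformal_pairs D p" and xn: "\<And>n. x n = norm (deriv (h n) 0)"
    using x(1) unfolding image_iff Bex_def split_paired_Ex prod.case by metis
  have hol: "\<And>n. h n holomorphic_on ?B" "\<And>n. g n holomorphic_on ?B"
    and im: "\<And>n z. z \<in> ?B \<Longrightarrow> h n z + cnj (g n z) \<in> D"
    and at0: "\<And>n. h n 0 = p" "\<And>n. g n 0 = 0" "\<And>n. deriv (g n) 0 = 0"
    using hg by (auto simp: conformal_pairs_def)
  \<comment> \<open>The conjugate map takes values in the reflected domain and has
    \<open>g n\<close> as its holomorphic part, so the derivative estimate applies to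
    \<open>g n\<close> as well.\<close>
  have im': "g n z + cnj (h n z) \<in> cnj ` D" if "z \<in> ?B" for n z
    using imageI[OF im[OF that, of n], of cnj] by (simp add: add.commute)
  have linear_cnj: "linear cnj" by (rule bounded_linear.linear[OF bounded_linear_cnj])
  have D': "open (cnj ` D)" "convex (cnj ` D)" "bounded (cnj ` D)" "cnj ` D \<noteq> {}"
  proof -
    show "open (cnj ` D)"
      unfolding image_cnj_conv_vimage_cnj by (intro open_vimage D continuous_intros)
  qed (use D ne in \<open>auto intro: convex_linear_image[OF linear_cnj] bounded_linear_image[OF _ bounded_linear_cnj]\<close>)
  have lh: "\<exists>B. \<forall>k\<in>range h. \<forall>z\<in>K. norm (k z) \<le> B" if "compact K" "K \<subseteq> ?B" for K
  proof (rule holomorphic_bounded_on_compacts[where C = ?C and a = p, OF _ _ _ that])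
    show "norm (deriv k z) * (1 - norm z) \<le> ?C" if "k \<in> range h" "z \<in> ?B" for k z
      using that norm_deriv_le_perimeter_within[OF D ne hol im] by auto
  qed (use hol at0 in auto)
  have lg: "\<exists>B. \<forall>k\<in>range g. \<forall>z\<in>K. norm (k z) \<le> B" if "compact K" "K \<subseteq> ?B" for K
  proof (rule holomorphic_bounded_on_compacts[where C = "perimeter (cnj ` D) / (2 * pi)" and a = 0, OF _ _ _ that])
    show "norm (deriv k z) * (1 - norm z) \<le> perimeter (cnj ` D) / (2 * pi)" if "k \<in> range g" "z \<in> ?B" for k z
      using that norm_deriv_le_perimeter_within[OF D' hol(2,1) im'] by auto
  qed (use hol at0 in auto)
  have hol': "\<And>k. k \<in> range h \<Longrightarrow> k holomorphic_on ?B" "\<And>k. k \<in> range g \<Longrightarrow> k holomorphic_on ?B"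
    using hol by auto
  have range_comp_subset: "range (g \<circ> q) \<subseteq> range g" for q :: "nat \<Rightarrow> nat" by auto
  obtain H r where H: "H holomorphic_on ?B" and r: "strict_mono (r :: nat \<Rightarrow> nat)"
    and Hlim: "\<And>z. z \<in> ?B \<Longrightarrow> (\<lambda>n. h (r n) z) \<longlonglongrightarrow> H z"
    and Hunif: "\<And>K. \<lbrakk>compact K; K \<subseteq> ?B\<rbrakk> \<Longrightarrow> uniform_limit K (h \<circ> r) H sequentially"
    by (rule Montel[OF open_ball hol'(1) lh order_refl]) (assumption | (rule that; blast))+
  \<comment> \<open>The second extraction is made along \<open>r\<close>, so that both components
    converge along the indices \<open>r (s n)\<close>.\<close>
  obtain G s where G: "G holomorphic_on ?B" and s: "strict_mono (s :: nat \<Rightarrow> nat)"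
    and Glim: "\<And>z. z \<in> ?B \<Longrightarrow> (\<lambda>n. (g \<circ> r) (s n) z) \<longlonglongrightarrow> G z"
    and Gunif: "\<And>K. \<lbrakk>compact K; K \<subseteq> ?B\<rbrakk> \<Longrightarrow> uniform_limit K ((g \<circ> r) \<circ> s) G sequentially"
    by (rule Montel[OF open_ball hol'(2) lg range_comp_subset]) (assumption | (rule that; blast))+
  have half: "cball (0::complex) (1/2) \<subseteq> ?B" by auto
  note U = uniform_limit_on_subset[OF Hunif[OF compact_cball half] ball_subset_cball]
    uniform_limit_on_subset[OF Gunif[OF compact_cball half] ball_subset_cball]
  have sub: "ball 0 (1/2) \<subseteq> ?B" by auto
  have dH: "(\<lambda>n. deriv ((h \<circ> r) n) 0) \<longlonglongrightarrow> deriv H 0"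
    by (rule deriv_complex_uniform_limit[OF U(1)]) (use holomorphic_on_subset[OF hol(1) sub] in auto)
  have dG: "(\<lambda>n. deriv (((g \<circ> r) \<circ> s) n) 0) \<longlonglongrightarrow> deriv G 0"
    by (rule deriv_complex_uniform_limit[OF U(2)]) (use holomorphic_on_subset[OF hol(2) sub] in auto)
  have "(\<lambda>n. x (r n)) \<longlonglongrightarrow> norm (deriv H 0)" using tendsto_norm[OF dH] by (simp add: xn)
  moreover have "(\<lambda>n. x (r n)) \<longlonglongrightarrow> L" using LIMSEQ_subseq_LIMSEQ[OF x(2) r] by (simp add: o_def)
  ultimately have L: "L = norm (deriv H 0)" by (metis LIMSEQ_unique)
  have dG0: "deriv G 0 = 0" using LIMSEQ_unique[OF dG] by (simp add: at0)
  have H0: "H 0 = p" using LIMSEQ_unique[OF Hlim[of 0]] by (simp add: at0)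
  have G0: "G 0 = 0" using LIMSEQ_unique[OF Glim[of 0]] by (simp add: at0)
  \<comment> \<open>Pointwise limits only land in the closure; since the value at 0 is
    \<open>p\<close> in D, the maximum principle then excludes the frontier.\<close>
  have cl: "H z + cnj (G z) \<in> closure D" if z: "z \<in> ?B" for z
  proof -
    have "(\<lambda>n. h (r (s n)) z + cnj (g (r (s n)) z)) \<longlonglongrightarrow> H z + cnj (G z)"
      using LIMSEQ_subseq_LIMSEQ[OF Hlim[OF z] s] Glim[OF z] by (auto simp: o_def intro!: tendsto_intros)
    then show ?thesis using im[OF z] unfolding closure_sequential
      by (intro exI[of _ "\<lambda>n. h (r (s n)) z + cnj (g (r (s n)) z)"]) simp
  qed
  have "H z + cnj (G z) \<in> D" if "z \<in> ?B" for z
    by (rule harmonic_image_in_convex_interior[OF D(1,2) open_ball connected_ball H G cl _ _ that, of 0])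
      (use p H0 G0 in auto)
  then have "(H, G) \<in> conformal_pairs D p" using H G H0 G0 dG0 by (auto simp: conformal_pairs_def)
  then show ?thesis unfolding L by (rule rev_image_eqI) simp
qed

theorem theorem2p1:
  fixes D :: "complex set" and p :: complex
  assumes "open D" and "connected D" and "D \<noteq> {}" and "bounded D" and "convex D"
    and "p \<in> D"
  shows "(\<exists>f. admissible D p f \<and> onorm (frechet_derivative f (at 0)) = M D p) \<and>
         M D p \<le> perimeter D / (2 * pi)"
proof -
  define V where "V = (\<lambda>(h, g). norm (deriv h 0)) ` conformal_pairs D p"
  have V_eq: "{onorm (frechet_derivative f (at 0)) | f. admissible D p f} = V"
  proof (intro equalityI subsetI)
    fix y assume "y \<in> {onorm (frechet_derivative f (at 0)) | f. admissible D p f}"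
    then show "y \<in> V" unfolding V_def using admissible_imp_conformal_pairs[of D p] by force
  next
    fix y assume "y \<in> V"
    then obtain h g where "(h, g) \<in> conformal_pairs D p" "y = norm (deriv h 0)" by (auto simp: V_def)
    then show "y \<in> {onorm (frechet_derivative f (at 0)) | f. admissible D p f}"
      using conformal_pairs_imp_admissible[of h g D p] by (intro CollectI exI[of _ "\<lambda>z. h z + cnj (g z)"]) simp
  qed
  have le: "y \<le> perimeter D / (2 * pi)" if "y \<in> V" for y
    using that norm_deriv_le_perimeter[of D] assms by (auto simp: V_def conformal_pairs_def)
  have ne: "V \<noteq> {}"
  proof -
    have "(\<lambda>z. p, \<lambda>z. 0) \<in> conformal_pairs D p" using assms(6) by (auto simp: conformal_pairs_def)
    then show ?thesis by (auto simp: V_def)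
  qed
  \<comment> \<open>\<open>M D p\<close> is a supremum of reals, meaningful because \<open>V\<close>
    is bounded and contains the value of the constant map. It is a limit of elements of
    \<open>V\<close>, so compactness shows that it is attained.\<close>
  have "bdd_above V" using le by (rule bdd_aboveI)
  then have "Sup V \<in> closure V" using closure_contains_Sup ne by blast
  then obtain x where x: "\<And>n. x n \<in> V" "x \<longlonglongrightarrow> Sup V" unfolding closure_sequential by blast
  have "Sup V \<in> V" 
    using conformal_pairs_extremal[OF assms(1,5,4,6) x[unfolded V_def]] by (simp only: V_def)
  moreover have "M D p = Sup V" unfolding M_def V_eq ..
  ultimately have "M D p \<in> {onorm (frechet_derivative f (at 0)) | f. admissible D p f}" "M D p \<in> V"
    unfolding V_eq by simp_all
  then show ?thesis using le by force
qed

end
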